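(* If $\mathcal{C}$ is a clone on a $k$-element set $A$ $(k\ge3)$ such that $T_A^-\subseteq\mathcal{C}$, then $\mathcal{C}\in\mathfrak{F}_A$ if and only if $\mathcal{B}_{k-1}(T_A^-)\subseteq\mathcal{C}$.
   Context: For $n\ge 1$, an $n$-ary operation on $A$ is a function $A^n\to A$; $\mathcal{O}_A$ is the set of all finitary operations on $A$, and $\mathcal{C}^{(n)}$ is the set of $n$-ary members of $\mathcal{C}\subseteq\mathcal{O}_A$. A clone on $A$ is a set $\mathcal{C}\subseteq\mathcal{O}_A$ containing all projections and closed under composition; $\langle F\rangle$ is the smallest clone containing $F\subseteq\mathcal{O}_A$. For a clone $\mathcal{C}$, an $n$-ary $f$ and an $m$-ary $g$ in $\mathcal{O}_A$, write $f\leq_{\mathcal{C}} g$ if $f=g(h_1,\dots,h_m)$ for some $h_1,\dots,h_m\in\mathcal{C}^{(n)}$, and $f\equiv_{\mathcal{C}}g$ if $f\leq_{\mathcal{C}}g$ and $g\leq_{\mathcal{C}}f$. $\mathfrak{F}_A$ denotes the set of all clones $\mathcal{C}$ on $A$ such that the equivalence relation $\equiv_{\mathcal{C}}$ on $\mathcal{O}_A$ has only finitely many classes. $T_A^-$ is the set of unary operations on $A$ consisting of the identity function and all functions $A\to A$ that are not permutations. $\mathcal{B}_{k-1}$ (Słupecki's clone) consists of all operations on $A$ depending on at most one variable and all operations whose range contains at most $k-1$ elements. $\mathcal{B}_{k-1}(T_A^-)$ is the clone obtained from $\mathcal{B}_{k-1}$ by omitting all operations depending on at most one variable that are outside the clone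 $\langle T_A^-\rangle$. *)

theory Defs
  imports Main "HOL-Library.FuncSet" "HOL-Library.Cardinality"
begin

text \<open>The base set \<open>A\<close> is the universe of a type \<open>'a\<close>. An \<open>n\<close>-ary operation is a pair \<open>(n, f)\<close>
  with \<open>f\<close> defined on the lists of length \<open>n\<close> and \<open>undefined\<close> elsewhere, so that equality of pairs
  is equality of operations (and operations of different arities are different).\<close>

type_synonym 'a operation = "nat \<times> ('a list \<Rightarrow> 'a)"

definition tuples :: "nat \<Rightarrow> 'a list set" where
  "tuples n = {xs. length xs = n}"

definition all_ops :: "'a operation set" where
  "all_ops = {(n, f). n \<ge> 1 \<and> f \<in> tuples n \<rightarrow>\<^sub>E UNIV}"

definition projection :: "nat \<Rightarrow> nat \<Rightarrow> 'a operation" where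
  "projection n i = (n, \<lambda>xs\<in>tuples n. xs ! i)"

text \<open>\<open>superpose n g [h\<^sub>1, \<dots>, h\<^sub>m]\<close> is the \<open>n\<close>-ary operation \<open>g(h\<^sub>1, \<dots>, h\<^sub>m)\<close>; it is only meant for
  \<open>g\<close> of arity \<open>m\<close> and all \<open>h\<^sub>j\<close> of arity \<open>n\<close>.\<close>

definition superpose :: "nat \<Rightarrow> ('a list \<Rightarrow> 'a) \<Rightarrow> ('a list \<Rightarrow> 'a) list \<Rightarrow> 'a operation" where
  "superpose n g hs = (n, \<lambda>xs\<in>tuples n. g (map (\<lambda>h. h xs) hs))"

definition is_clone :: "'a operation set \<Rightarrow> bool" where
  "is_clone C \<longleftrightarrow> C \<subseteq> all_ops
     \<and> (\<forall>n i. i < n \<longrightarrow> projection n i \<in> C)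
     \<and> (\<forall>m g n hs. (m, g) \<in> C \<and> length hs = m \<and> (\<forall>h\<in>set hs. (n, h) \<in> C) \<longrightarrow> superpose n g hs \<in> C)"

definition clone_generated :: "'a operation set \<Rightarrow> 'a operation set" where
  "clone_generated F = \<Inter> {C. is_clone C \<and> F \<subseteq> C}"

definition clone_le :: "'a operation set \<Rightarrow> 'a operation \<Rightarrow> 'a operation \<Rightarrow> bool" where
  "clone_le C = (\<lambda>(n, f) (m, g).
     \<exists>hs. length hs = m \<and> (\<forall>h\<in>set hs. (n, h) \<in> C) \<and> (n, f) = superpose n g hs)"

definition clone_equiv :: "'a operation set \<Rightarrow> ('a operation \<times> 'a operation) set" where
  "clone_equiv C = {(f, g). f \<in> all_ops \<and> g \<in> all_ops \<and> clone_le C f g \<and> clone_le C g f}"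

text \<open>The set of clones written \<open>\<FF>\<^sub>A\<close>.\<close>

definition finitely_many_classes :: "'a operation set set" where
  "finitely_many_classes = {C. is_clone C \<and> finite (all_ops // clone_equiv C)}"

definition unary :: "('a \<Rightarrow> 'a) \<Rightarrow> 'a operation" where
  "unary t = (1, \<lambda>xs\<in>tuples 1. t (xs ! 0))"

definition T_minus :: "'a operation set" where
  "T_minus = unary ` {t. t = id \<or> \<not> bij t}"

definition depends_on :: "'a operation \<Rightarrow> nat \<Rightarrow> bool" where
  "depends_on = (\<lambda>(n, f) i. i < n \<and> (\<exists>xs\<in>tuples n. \<exists>y. f (xs[i := y]) \<noteq> f xs))"

definition essentially_unary :: "'a operation set" where
  "essentially_unary = {f \<in> all_ops. card {i. depends_on f i} \<le> 1}"

definition op_range :: "'a operation \<Rightarrow> 'a set" where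
  "op_range = (\<lambda>(n, f). f ` tuples n)"

text \<open>The operations with at most \<open>k - 1\<close> values, \<open>k = |A|\<close>, together with the essentially
  unary operations (\<open>\<B>\<^bsub>k-1\<^esub>\<close>), and the subclone \<open>\<B>\<^bsub>k-1\<^esub>(T\<^sub>A\<^sup>-)\<close>.\<close>

definition slupecki :: "'a::finite operation set" where
  "slupecki = essentially_unary \<union> {f \<in> all_ops. card (op_range f) \<le> CARD('a) - 1}"

definition slupecki_T_minus :: "'a::finite operation set" where
  "slupecki_T_minus = slupecki - (essentially_unary - clone_generated T_minus)"


lemma superpose_in_all_ops: "n \<ge> 1 \<Longrightarrow> superpose n g hs \<in> all_ops"
  by (simp add: superpose_def all_ops_def)

lemma is_clone_all_ops: "is_clone (all_ops :: 'a operation set)"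
  unfolding is_clone_def
proof (intro conjI allI impI)
  fix n i :: nat assume "i < n"
  then show "projection n i \<in> (all_ops :: 'a operation set)"
    by (simp add: projection_def all_ops_def)
next
  fix m n and g :: "'a list \<Rightarrow> 'a" and hs :: "('a list \<Rightarrow> 'a) list"
  assume a: "(m, g) \<in> all_ops \<and> length hs = m \<and> (\<forall>h\<in>set hs. (n, h) \<in> all_ops)"
  then have "hs \<noteq> []" by (auto simp: all_ops_def)
  then have "n \<ge> 1" using a by (cases hs) (auto simp: all_ops_def)
  then show "superpose n g hs \<in> all_ops" by (rule superpose_in_all_ops)
qed simp

lemma is_clone_generated: "is_clone (clone_generated F)" if "F \<subseteq> all_ops"
proof -
  have "clone_generated F \<subseteq> all_ops"
    using is_clone_all_ops that by (auto simp: clone_generated_def)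
  then show ?thesis
    unfolding is_clone_def
    by (auto simp: clone_generated_def is_clone_def)
qed

lemma clone_le_refl:
  assumes "is_clone C" "f \<in> all_ops" shows "clone_le C f f"
proof -
  obtain n g where f: "f = (n, g)" by (cases f)
  let ?hs = "map (\<lambda>i. snd (projection n i :: 'a operation)) [0..<n]"
  have "map (\<lambda>h. h xs) ?hs = xs" if "length xs = n" for xs :: "'a list"
    using that by (auto simp: projection_def tuples_def intro: nth_equalityI)
  then have "(n, g) = superpose n g ?hs"
    using assms(2) unfolding f all_ops_def superpose_def
    by (auto simp: tuples_def PiE_def extensional_def restrict_def fun_eq_iff simp del: map_map)
  moreover have "\<forall>h\<in>set ?hs. (n, h) \<in> C"
    using assms(1) by (auto simp: is_clone_def projection_def)
  ultimately show ?thesis unfolding f clone_le_def by (auto intro!: exI[of _ ?hs])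
qed

lemma clone_le_trans:
  assumes C: "is_clone C" and "clone_le C f g" "clone_le C g h" shows "clone_le C f h"
proof -
  obtain n f' m g' p h' where e: "f = (n, f')" "g = (m, g')" "h = (p, h')"
    by (cases f, cases g, cases h)
  obtain us vs where us: "length us = m" "\<forall>u\<in>set us. (n, u) \<in> C" "(n, f') = superpose n g' us"
    and vs: "length vs = p" "\<forall>v\<in>set vs. (m, v) \<in> C" "(m, g') = superpose m h' vs"
    using assms(2,3) unfolding e clone_le_def by auto
  let ?ws = "map (\<lambda>v. snd (superpose n v us)) vs"
  have "\<forall>w\<in>set ?ws. (n, w) \<in> C"
  proof
    fix w assume "w \<in> set ?ws"
    then obtain v where v: "v \<in> set vs" "w = snd (superpose n v us)" by auto
    then have "superpose n v us \<in> C" using C us vs unfolding is_clone_def by blast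
    then show "(n, w) \<in> C" using v by (simp add: superpose_def)
  qed
  moreover have "(n, f') = superpose n h' ?ws"
    using us vs unfolding superpose_def
    by (auto simp: tuples_def restrict_def fun_eq_iff o_def cong: map_cong)
  ultimately have "length ?ws = p \<and> (\<forall>w\<in>set ?ws. (n, w) \<in> C) \<and> (n, f') = superpose n h' ?ws"
    using vs by simp
  then show ?thesis unfolding e clone_le_def split by blast
qed

lemma equiv_clone_equiv: "is_clone C \<Longrightarrow> equiv all_ops (clone_equiv C)"
  by (rule equivI)
    (auto simp: clone_equiv_def intro!: refl_onI symI transI
      intro: clone_le_refl clone_le_trans)

end

theory Submission
  imports Defs
begin

text \<open>
  Yablonskii's lemma drives both directions: an operation \<open>g\<close> that depends on two variables and
  takes at least \<open>s \<ge> 3\<close> values already takes \<open>s\<close> values on \<open>s\<close> tuples with fewer than \<open>s\<close> entries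
  in each coordinate. Choosing preimages among these tuples, every \<open>f\<close> whose range lies in the
  values so obtained is \<open>g(h\<^sub>1, \<dots>, h\<^sub>m)\<close> with all \<open>h\<^sub>j\<close> of range smaller than \<open>s\<close>.

  If \<open>C\<close> contains all operations of range at most \<open>k - 1\<close>, then (with \<open>s = k\<close>) all surjective
  operations depending on two variables are equivalent, and the remaining ones are classified by
  their range or by a single permutation.

  Conversely let \<open>f\<^sub>n(a, \<dots>, a) = a\<close> and let \<open>f\<^sub>n\<close> be a constant \<open>z\<close> on all other tuples. If \<open>C\<close> lacks
  some operation with two values, then the traces of the members of \<open>C\<close> on a two-element set are
  affine and a dimension count shows that \<open>f\<^sub>n \<le> f\<^sub>m\<close> forces \<open>n \<le> m\<close>. The same holds when all members of
  \<open>C\<close> are essentially unary or have range at most \<open>k - 2\<close>, because only operations taking all values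
  other than \<open>z\<close> can be substituted. So finiteness yields all two-valued operations and then,
  increasing \<open>s\<close> up to \<open>k - 1\<close>, all operations of range at most \<open>k - 1\<close>.
\<close>

section \<open>Essential variables\<close>

text \<open>Essential unarity with its variable \<open>i\<close> and its map \<open>t\<close> as
  explicit data. The map is determined by \<open>f\<close>, through the values of \<open>f\<close>
  on constant tuples.\<close>

definition unary_form :: "nat \<Rightarrow> ('a list \<Rightarrow> 'a) \<Rightarrow> nat \<Rightarrow> ('a \<Rightarrow> 'a) \<Rightarrow> bool" where
  "unary_form n f i t \<longleftrightarrow> i < n \<and> (\<forall>xs\<in>tuples n. f xs = t (xs ! i))"

text \<open>Replace the entries of \<open>xs\<close> by those of \<open>ys\<close> one coordinate at
  a time: only coordinate \<open>i\<close> could change the value, and there the entries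
  coincide.\<close>

lemma eq_if_agree_on_essential:
  fixes f :: "'a list \<Rightarrow> 'a"
  assumes "\<And>j. depends_on (n, f) j \<Longrightarrow> j = i"
    and "length xs = n" "length ys = n" "i < n \<Longrightarrow> xs ! i = ys ! i"
  shows "f xs = f ys"
proof -
  have "f (take m ys @ drop m xs) = f xs" if "m \<le> n" for m
    using that
  proof (induction m)
    case (Suc m)
    let ?l = "take m ys @ drop m xs"
    have l: "length ?l = n" using Suc.prems assms by simp
    have eq: "take (Suc m) ys @ drop (Suc m) xs = ?l[m := ys ! m]"
      using Suc.prems assms(2,3)
      by (intro nth_equalityI) (auto simp: nth_append nth_list_update less_Suc_eq)
    have "f (?l[m := ys ! m]) = f ?l"
    proof (cases "m = i")
      case True
      then have "?l[m := ys ! m] = ?l"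
        using Suc.prems assms(2,3,4) by (intro list_update_same_conv[THEN iffD2]) (auto simp: nth_append)
      then show ?thesis by simp
    next
      case False
      then have "\<not> depends_on (n, f) m" using assms(1) by blast
      then have "\<forall>zs\<in>tuples n. \<forall>y. f (zs[m := y]) = f zs"
        using Suc.prems by (simp add: depends_on_def)
      moreover have "?l \<in> tuples n" using l by (simp add: tuples_def)
      ultimately show ?thesis by blast
    qed
    also have "f ?l = f xs" using Suc by (intro Suc.IH) linarith
    finally show ?case unfolding eq .
  qed simp
  from this[of n] show ?thesis using assms(2,3) by simp
qed

lemma unary_form_if_depends_only_on:
  fixes f :: "'a list \<Rightarrow> 'a"
  assumes "\<And>j. depends_on (n, f) j \<Longrightarrow> j = i" "i < n"
  shows "unary_form n f i (\<lambda>a. f (replicate n a))"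
  unfolding unary_form_def
proof (intro conjI ballI)
  fix xs :: "'a list" assume "xs \<in> tuples n"
  then show "f xs = f (replicate n (xs ! i))"
    using eq_if_agree_on_essential[OF assms(1), where xs = xs and ys = "replicate n (xs ! i)"] by (simp add: tuples_def)
qed (rule assms(2))

lemma two_essential_variables:
  fixes f :: "'a list \<Rightarrow> 'a"
  assumes "\<And>i t. \<not> unary_form n f i t" "n \<ge> 1"
  obtains i j where "i \<noteq> j" "depends_on (n, f) i" "depends_on (n, f) j"
proof -
  \<comment> \<open>If no variable were essential, any coordinate, here 0, would give a unary
    form.\<close>
  from unary_form_if_depends_only_on[of n f 0] assms
  obtain i where i: "depends_on (n, f) i" by fastforce
  then have "i < n" by (simp add: depends_on_def)
  with unary_form_if_depends_only_on[of n f i] assms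
  obtain j where "depends_on (n, f) j" "j \<noteq> i" by fastforce
  with i that show ?thesis by blast
qed

lemma essentially_unary_imp_unary_form:
  assumes "(n, f) \<in> essentially_unary"
  obtains i t where "unary_form n f i t"
proof (rule ccontr)
  assume "\<not> thesis"
  then have "\<And>i t. \<not> unary_form n f i t" using that by blast
  moreover have "n \<ge> 1" using assms by (auto simp: essentially_unary_def all_ops_def)
  ultimately obtain i j where ij: "i \<noteq> j" "depends_on (n, f) i" "depends_on (n, f) j"
    using two_essential_variables by metis
  have "finite {i. depends_on (n, f) i}"
    by (rule finite_subset[of _ "{..<n}"]) (auto simp: depends_on_def)
  with ij have "card {i, j} \<le> card {i. depends_on (n, f) i}"
    by (intro card_mono) auto
  with ij assms show False by (simp add: essentially_unary_def)
qed

text \<open>The three tuples have at most two distinct entries in every coordinate. To find them,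
  consider the lines in direction \<open>i\<close> on which \<open>f\<close> is not constant: either
  some such line misses a value of \<open>f\<close>, or all of them take every value.\<close>

lemma yablonskii_three_values:
  fixes f :: "'a list \<Rightarrow> 'a"
  assumes ij: "i \<noteq> j" "depends_on (n, f) i" "depends_on (n, f) j"
    and three: "\<And>v w. \<exists>zs\<in>tuples n. f zs \<noteq> v \<and> f zs \<noteq> w"
  obtains xs ys b where "xs \<in> tuples n" "ys \<in> tuples n" "ys ! i = xs ! i"
    "f xs \<noteq> f (xs[i := b])" "f xs \<noteq> f ys" "f ys \<noteq> f (xs[i := b])"
proof -
  have "i < n" "j < n" using ij by (auto simp: depends_on_def)
  have upd: "xs[i := a] \<in> tuples n" if "xs \<in> tuples n" for xs :: "'a list" and a
    using that by (simp add: tuples_def)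
  have upd_nth: "xs[i := a] ! i = a" if "xs \<in> tuples n" for xs :: "'a list" and a
    using that \<open>i < n\<close> by (simp add: tuples_def)
  obtain cs y where cs: "cs \<in> tuples n" "f (cs[i := y]) \<noteq> f cs"
    using ij(2) by (auto simp: depends_on_def)
  obtain ds y' where ds: "ds \<in> tuples n" "f (ds[j := y']) \<noteq> f ds"
    using ij(3) by (auto simp: depends_on_def)
  define ds' where "ds' = ds[j := y']"
  have ds': "ds' \<in> tuples n" "ds' ! i = ds ! i" "f ds' \<noteq> f ds"
    using ds ij(1) by (auto simp: ds'_def tuples_def)
  show thesis
  proof (cases "\<exists>xs\<in>tuples n. \<exists>b. \<exists>zs\<in>tuples n. f (xs[i := b]) \<noteq> f xs \<and> (\<forall>a. f (xs[i := a]) \<noteq> f zs)")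
    case True
    then obtain xs b zs where xs: "xs \<in> tuples n" "zs \<in> tuples n" "f (xs[i := b]) \<noteq> f xs"
        "\<And>a. f (xs[i := a]) \<noteq> f zs" by blast
    \<comment> \<open>Moving along the line, which misses the value \<open>f zs\<close>, gives a
      tuple that agrees with \<open>zs\<close> in coordinate \<open>i\<close>.\<close>
    define ws where "ws = xs[i := zs ! i]"
    have ws: "ws \<in> tuples n" "zs ! i = ws ! i" using xs upd upd_nth by (auto simp: ws_def)
    obtain b' where b': "f (ws[i := b']) \<noteq> f ws"
    proof (cases "f ws = f xs")
      case True
      then show ?thesis using xs(3) that[of b] by (simp add: ws_def)
    next
      case False
      then show ?thesis using that[of "xs ! i"] by (simp add: ws_def)
    qed
    have "f ws \<noteq> f zs" "f (ws[i := b']) \<noteq> f zs" using xs(4) by (simp_all add: ws_def)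
    then show ?thesis using that[OF ws(1) xs(2) ws(2)] b' by metis
  next
    case False
    then have row: "\<exists>a. f (xs[i := a]) = f zs"
      if "xs \<in> tuples n" "zs \<in> tuples n" "f (xs[i := b]) \<noteq> f xs" for xs zs b
      using that by blast
    note thesis_intro = that
    \<comment> \<open>The nonconstant line through \<open>xs\<close> takes every value, hence also
      one different from \<open>f xs\<close> and \<open>f ys\<close>.\<close>
    have full: thesis if "xs \<in> tuples n" "ys \<in> tuples n" "ys ! i = xs ! i" "f xs \<noteq> f ys"
      "f (xs[i := b]) \<noteq> f xs" for xs ys b
    proof -
      obtain zs where "zs \<in> tuples n" "f zs \<noteq> f xs" "f zs \<noteq> f ys" using three by blast
      moreover from row[OF that(1) this(1) that(5)] obtain a where "f (xs[i := a]) = f zs" by blast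
      ultimately show thesis using that by (intro thesis_intro[of xs ys a]) simp_all
    qed
    show ?thesis
    proof (cases "\<exists>b. f (ds[i := b]) \<noteq> f ds \<or> f (ds'[i := b]) \<noteq> f ds'")
      case True
      then show ?thesis
        using full[OF ds(1) ds'(1,2)] full[OF ds'(1) ds(1) ds'(2)[symmetric]] ds'(3) by metis
    next
      \<comment> \<open>As \<open>f\<close> is constant on the line through \<open>ds\<close>, this
        tuple can be moved, without changing its value, to the entry \<open>a\<close> at which the
        line through \<open>cs\<close> takes a third value.\<close>
      case const: False
      obtain zs where zs: "zs \<in> tuples n" "f zs \<noteq> f ds" "f zs \<noteq> f ds'" using three by blast
      obtain a where a: "f (cs[i := a]) = f zs" using row[OF cs(1) zs(1) cs(2)] by blast
      obtain b where b: "f (cs[i := b]) = f ds'" using row[OF cs(1) ds'(1) cs(2)] by blast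
      have "f (ds[i := a]) = f ds" using const by blast
      then show ?thesis
        using that[OF upd[OF cs(1)] upd[OF ds(1)], of a a b] a b zs(2,3) ds'(3) upd_nth[OF cs(1)]
          upd_nth[OF ds(1)] by simp
    qed
  qed
qed

text \<open>The tuples of \<open>yablonskii_three_values\<close> use at most two entries per
  coordinate. Adding \<open>s - 3\<close> tuples, one for each further value, brings this to at most
  \<open>s - 1\<close>.\<close>

lemma yablonskii:
  fixes f :: "'a::finite list \<Rightarrow> 'a"
  assumes nonunary: "\<And>i t. \<not> unary_form n f i t" and "n \<ge> 1"
    and s: "3 \<le> s" "s \<le> card (f ` tuples n)"
  obtains X where "X \<subseteq> tuples n" "card (f ` X) = s"
    "\<And>l. l < n \<Longrightarrow> card ((\<lambda>xs. xs ! l) ` X) < s"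
proof -
  obtain i j where ij: "i \<noteq> j" "depends_on (n, f) i" "depends_on (n, f) j"
    using two_essential_variables[OF nonunary \<open>n \<ge> 1\<close>] by blast
  have "\<exists>zs\<in>tuples n. f zs \<noteq> v \<and> f zs \<noteq> w" for v w
  proof (rule ccontr)
    assume "\<not> ?thesis"
    then have "f ` tuples n \<subseteq> {v, w}" by auto
    then have "card (f ` tuples n) \<le> card {v, w}" by (intro card_mono) auto
    also have "\<dots> \<le> 2" by (simp add: card_insert_if)
    finally show False using s by simp
  qed
  then obtain xs ys b where xs: "xs \<in> tuples n" "ys \<in> tuples n" "ys ! i = xs ! i"
    "f xs \<noteq> f (xs[i := b])" "f xs \<noteq> f ys" "f ys \<noteq> f (xs[i := b])"
    using yablonskii_three_values[OF ij] by metis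
  define X3 where "X3 = {xs, xs[i := b], ys}"
  have X3: "X3 \<subseteq> tuples n" "card (f ` X3) = 3" using xs by (auto simp: X3_def tuples_def)
  have coord: "card ((\<lambda>xs. xs ! l) ` X3) \<le> 2" if "l < n" for l
  proof -
    \<comment> \<open>In coordinate \<open>i\<close> the tuple \<open>ys\<close> repeats the entry
      of \<open>xs\<close>; in all other coordinates \<open>xs[i := b]\<close> does.\<close>
    have "(\<lambda>xs. xs ! l) ` X3 \<subseteq> {xs ! l, if l = i then b else ys ! l}"
      using xs that by (auto simp: X3_def nth_list_update tuples_def)
    then have "card ((\<lambda>xs. xs ! l) ` X3) \<le> card {xs ! l, if l = i then b else ys ! l}"
      by (intro card_mono) auto
    also have "\<dots> \<le> 2" by (simp add: card_insert_if)
    finally show ?thesis .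
  qed
  have "s - 3 \<le> card (f ` tuples n - f ` X3)"
    using s X3 by (subst card_Diff_subset) auto
  then obtain V where V: "V \<subseteq> f ` tuples n - f ` X3" "card V = s - 3"
    by (meson obtain_subset_with_card_n)
  then obtain Y where Y: "Y \<subseteq> tuples n" "f ` Y = V" "inj_on f Y"
    by (metis Diff_subset subset_image_inj subset_trans)
  have "finite Y" using Y(2,3) by (metis finite finite_imageD)
  have "card Y = s - 3" using Y V by (metis card_image)
  show thesis
  proof (rule that[of "X3 \<union> Y"])
    show "X3 \<union> Y \<subseteq> tuples n" using X3 Y by simp
    have "f ` X3 \<inter> V = {}" using V by auto
    then show "card (f ` (X3 \<union> Y)) = s"
      using X3 Y V s by (simp add: image_Un card_Un_disjoint)
    fix l assume "l < n"
    have "card ((\<lambda>xs. xs ! l) ` (X3 \<union> Y)) \<le> card ((\<lambda>xs. xs ! l) ` X3) + card ((\<lambda>xs. xs ! l) ` Y)"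
      by (simp add: image_Un card_Un_le)
    also have "\<dots> \<le> 2 + (s - 3)"
      using coord[OF \<open>l < n\<close>] card_image_le[OF \<open>finite Y\<close>, of "\<lambda>xs. xs ! l"] \<open>card Y = s - 3\<close>
      by linarith
    also have "\<dots> < s" using s by simp
    finally show "card ((\<lambda>xs. xs ! l) ` (X3 \<union> Y)) < s" .
  qed
qed

section \<open>Clones containing the non-permutations\<close>

definition small_ops :: "nat \<Rightarrow> 'a operation set" where
  "small_ops r = {f \<in> all_ops. card (op_range f) \<le> r}"

lemma all_ops_restrict: "(n, f) \<in> all_ops \<Longrightarrow> restrict f (tuples n) = f"
  by (auto simp: all_ops_def PiE_def extensional_restrict)

lemma op_range_restrict [simp]: "op_range (n, restrict f (tuples n)) = f ` tuples n"
  by (auto simp: op_range_def)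

lemma restrict_in_all_ops [simp]: "(n, restrict f (tuples n)) \<in> all_ops \<longleftrightarrow> n \<ge> 1"
  by (simp add: all_ops_def)

lemma tuples_nonempty: "(tuples n :: 'a list set) \<noteq> {}"
  by (auto simp: tuples_def intro!: exI[of _ "replicate n undefined"])

lemma small_opsI:
  fixes f :: "'a::finite list \<Rightarrow> 'a"
  assumes "n \<ge> 1" "f ` tuples n \<subseteq> B" "card B \<le> r"
  shows "(n, restrict f (tuples n)) \<in> small_ops r"
proof -
  have "card (f ` tuples n) \<le> card B" using assms(2) by (intro card_mono) auto
  with assms show ?thesis by (simp add: small_ops_def)
qed

text \<open>The \<open>l\<close>-th inner operation is the \<open>l\<close>-th entry of a chosen
  preimage in \<open>X\<close>. It takes at most \<open>r\<close> values and so lies in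
  \<open>C\<close>, however large the range of \<open>f\<close> is.\<close>

lemma clone_le_via_preimages:
  fixes f g :: "'a::finite list \<Rightarrow> 'a"
  assumes small: "small_ops r \<subseteq> C" and f: "(n, f) \<in> all_ops"
    and X: "X \<subseteq> tuples m" "\<And>l. l < m \<Longrightarrow> card ((\<lambda>xs. xs ! l) ` X) \<le> r"
    and range: "f ` tuples n \<subseteq> g ` X"
  shows "clone_le C (n, f) (m, g)"
proof -
  define p where "p a = (SOME xs. xs \<in> X \<and> g xs = a)" for a
  have p: "p (f xs) \<in> X \<and> g (p (f xs)) = f xs" if "xs \<in> tuples n" for xs
  proof -
    have "\<exists>ys. ys \<in> X \<and> g ys = f xs" using range that by (metis image_eqI image_iff subsetD)
    then show ?thesis unfolding p_def by (rule someI_ex)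
  qed
  define hs where "hs = map (\<lambda>l. \<lambda>xs\<in>tuples n. p (f xs) ! l) [0..<m]"
  have n: "n \<ge> 1" using f by (simp add: all_ops_def)
  have "(n, h) \<in> C" if h: "h \<in> set hs" for h
  proof -
    obtain l where l: "l < m" "h = (\<lambda>xs\<in>tuples n. p (f xs) ! l)" using h by (auto simp: hs_def)
    show ?thesis unfolding l(2)
      by (rule subsetD[OF small], rule small_opsI[where B = "(\<lambda>xs. xs ! l) ` X"]) (use n p X l in auto)
  qed
  moreover have "(n, f) = superpose n g hs"
  proof -
    have "map (\<lambda>h. h xs) hs = p (f xs)" if "xs \<in> tuples n" for xs
      using that p[OF that] X(1) by (auto simp: hs_def tuples_def intro!: nth_equalityI)
    then have "(\<lambda>xs\<in>tuples n. g (map (\<lambda>h. h xs) hs)) = restrict f (tuples n)"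
      using p by (intro restrict_ext) simp
    then show ?thesis using f by (simp add: superpose_def all_ops_restrict)
  qed
  moreover have "length hs = m" by (simp add: hs_def)
  ultimately show ?thesis unfolding clone_le_def split by blast
qed

locale clone_above_T_minus =
  fixes C :: "'a::finite operation set"
  assumes clone: "is_clone C" and T_minus: "T_minus \<subseteq> C"
begin

lemma C_all_ops: "C \<subseteq> all_ops"
  using clone by (simp add: is_clone_def)

lemma compose_in:
  assumes "(m, g) \<in> C" "length hs = m" "\<And>h. h \<in> set hs \<Longrightarrow> (n, restrict h (tuples n)) \<in> C"
  shows "(n, \<lambda>xs\<in>tuples n. g (map (\<lambda>h. h xs) hs)) \<in> C"
proof -
  let ?hs = "map (\<lambda>h. restrict h (tuples n)) hs"
  have "\<forall>h\<in>set ?hs. (n, h) \<in> C" "length ?hs = m" using assms(2,3) by simp_all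
  then have "superpose n g ?hs \<in> C" using assms(1) clone unfolding is_clone_def by blast
  moreover have "superpose n g ?hs = (n, \<lambda>xs\<in>tuples n. g (map (\<lambda>h. h xs) hs))"
    by (auto simp: superpose_def o_def intro!: restrict_ext)
  ultimately show ?thesis by simp
qed

lemma proj_in: "i < n \<Longrightarrow> (n, \<lambda>xs\<in>tuples n. xs ! i) \<in> C"
  using clone unfolding is_clone_def projection_def by blast

text \<open>The form in which the non-permutations of \<open>T_minus\<close> serve to build members
  of \<open>C\<close>.\<close>

lemma unary_comp_in:
  assumes "(n, restrict f (tuples n)) \<in> C" "\<not> bij t"
  shows "(n, \<lambda>xs\<in>tuples n. t (f xs)) \<in> C"
proof -
  have "unary t \<in> C" using T_minus assms(2) by (auto simp: T_minus_def)
  then have "(n, \<lambda>xs\<in>tuples n. (\<lambda>xs\<in>tuples 1. t (xs ! 0)) (map (\<lambda>h. h xs) [f])) \<in> C"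
    unfolding unary_def by (rule compose_in) (use assms(1) in auto)
  then show ?thesis by (simp add: tuples_def)
qed

lemma not_bij_if_range:
  fixes t :: "'a \<Rightarrow> 'a"
  assumes "t ` UNIV \<subseteq> B" "card B < CARD('a)"
  shows "\<not> bij t"
proof
  assume "bij t"
  then have "t ` UNIV = UNIV" by (rule bij_is_surj)
  then show False using card_mono[OF finite assms(1)] assms(2) by simp
qed

lemma clone_le_imp_in:
  assumes "clone_le C f g" "g \<in> C"
  shows "f \<in> C"
proof -
  obtain n f' m g' where e: "f = (n, f')" "g = (m, g')" by (cases f, cases g)
  then obtain hs where "length hs = m" "\<forall>h\<in>set hs. (n, h) \<in> C" "f = superpose n g' hs"
    using assms(1) by (auto simp: clone_le_def)
  moreover have "(m, g') \<in> C" using assms(2) e by simp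
  ultimately have "superpose n g' hs \<in> C" using clone unfolding is_clone_def by blast
  with \<open>f = superpose n g' hs\<close> show ?thesis by simp
qed

text \<open>Yablonskii's lemma with \<open>s = Suc r\<close> yields the operations whose range lies
  in a certain set of \<open>Suc r\<close> values of \<open>g\<close>. Any other range of that size
  is relabelled into this set and back, and the map back is not a permutation.\<close>

lemma small_ops_Suc_subset:
  assumes r: "2 \<le> r" "Suc r < CARD('a)" and small: "small_ops r \<subseteq> C"
    and g: "(m, g) \<in> C" "\<And>i t. \<not> unary_form m g i t" "r < card (op_range (m, g))"
  shows "small_ops (Suc r) \<subseteq> C"
proof
  fix f' :: "'a operation" assume f': "f' \<in> small_ops (Suc r)"
  obtain n f where f: "f' = (n, f)" by (cases f')
  have "m \<ge> 1" using g(1) C_all_ops by (auto simp: all_ops_def)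
  moreover have "3 \<le> Suc r" "Suc r \<le> card (g ` tuples m)" using g(3) r by (auto simp: op_range_def)
  ultimately obtain X where X: "X \<subseteq> tuples m" "card (g ` X) = Suc r"
    "\<And>l. l < m \<Longrightarrow> card ((\<lambda>xs. xs ! l) ` X) < Suc r"
    by (rule yablonskii[OF g(2)]) blast
  have fo: "(n, f) \<in> all_ops" "card (f ` tuples n) \<le> Suc r" "n \<ge> 1"
    using f' f by (auto simp: small_ops_def op_range_def all_ops_def)
  then obtain \<rho> where \<rho>: "\<rho> ` (f ` tuples n) \<subseteq> g ` X" "inj_on \<rho> (f ` tuples n)"
    using inj_on_iff_card_le[OF finite finite, of "f ` tuples n" "g ` X"] X(2) by auto
  obtain c where c: "c \<in> f ` tuples n" using tuples_nonempty by blast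
  \<comment> \<open>The default \<open>c\<close> keeps the range of \<open>\<tau>\<close> inside the
    range of \<open>f\<close>, which is not the whole base set.\<close>
  define \<tau> where "\<tau> a = (if a \<in> \<rho> ` (f ` tuples n) then inv_into (f ` tuples n) \<rho> a else c)" for a
  have "(n, \<lambda>xs\<in>tuples n. \<rho> (f xs)) \<in> C"
  proof (rule clone_le_imp_in[OF clone_le_via_preimages])
    show "(\<lambda>xs\<in>tuples n. \<rho> (f xs)) ` tuples n \<subseteq> g ` X" using \<rho>(1) by auto
    show "card ((\<lambda>xs. xs ! l) ` X) \<le> r" if "l < m" for l using X(3)[OF that] by simp
  qed (use g small X fo in auto)
  moreover have "\<not> bij \<tau>"
  proof (rule not_bij_if_range)
    show "\<tau> ` UNIV \<subseteq> f ` tuples n"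
      unfolding \<tau>_def using c by (auto intro: inv_into_into simp del: image_iff)
    show "card (f ` tuples n) < CARD('a)" using fo r by linarith
  qed
  ultimately have "(n, \<lambda>xs\<in>tuples n. \<tau> (\<rho> (f xs))) \<in> C" by (rule unary_comp_in)
  also have "(\<lambda>xs\<in>tuples n. \<tau> (\<rho> (f xs))) = restrict f (tuples n)"
    using \<rho>(2) by (intro restrict_ext) (simp add: \<tau>_def)
  finally show "f' \<in> C" using fo f by (simp add: all_ops_restrict)
qed

text \<open>For surjective \<open>g\<close>, Yablonskii's lemma with \<open>s = CARD('a)\<close>
  supplies the preimages; otherwise one preimage per value already makes fewer than
  \<open>CARD('a)\<close> tuples.\<close>

lemma clone_le_if_same_range:
  assumes k: "CARD('a) \<ge> 3" and small: "small_ops (CARD('a) - 1) \<subseteq> C"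
    and fg: "(n, f) \<in> all_ops" "(m, g) \<in> all_ops"
    and range: "op_range (n, f) = op_range (m, g)" and nonunary: "\<And>i t. \<not> unary_form m g i t"
  shows "clone_le C (n, f) (m, g)"
proof -
  have range': "f ` tuples n = g ` tuples m" using range by (simp add: op_range_def)
  have m: "m \<ge> 1" using fg by (simp add: all_ops_def)
  obtain X where X: "X \<subseteq> tuples m" "g ` tuples m \<subseteq> g ` X"
      "\<And>l. l < m \<Longrightarrow> card ((\<lambda>xs. xs ! l) ` X) < CARD('a)"
  proof (cases "g ` tuples m = UNIV")
    case True
    then have "CARD('a) \<le> card (g ` tuples m)" by simp
    then obtain X where X: "X \<subseteq> tuples m" "card (g ` X) = CARD('a)"
      "\<And>l. l < m \<Longrightarrow> card ((\<lambda>xs. xs ! l) ` X) < CARD('a)"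
      by (rule yablonskii[OF nonunary m k]) blast
    then have "g ` X = UNIV" by (intro card_eq_UNIV_imp_eq_UNIV) auto
    then show ?thesis using that[of X] X by simp
  next
    case False
    then have less: "card (g ` tuples m) < CARD('a)" by (intro psubset_card_mono) auto
    obtain X where X: "X \<subseteq> tuples m" "g ` X = g ` tuples m" "inj_on g X"
      using subset_image_inj[of "g ` tuples m" g "tuples m"] by auto
    have "finite X" by (rule finite_imageD[OF finite X(3)])
    have "card X < CARD('a)" using less X(2) card_image[OF X(3)] by simp
    show ?thesis
    proof (rule that[of X])
      show "card ((\<lambda>xs. xs ! l) ` X) < CARD('a)" for l
        using card_image_le[OF \<open>finite X\<close>, of "\<lambda>xs. xs ! l"] \<open>card X < CARD('a)\<close> by linarith
    qed (use X in auto)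
  qed
  have "card ((\<lambda>xs. xs ! l) ` X) \<le> CARD('a) - 1" if "l < m" for l
    using X(3)[OF that] by linarith
  then show ?thesis using clone_le_via_preimages[OF small fg(1) X(1)] X(2) range' by simp
qed

text \<open>Substitute the \<open>i\<close>-th projection for every argument of
  \<open>g\<close>.\<close>

lemma clone_le_if_same_unary_form:
  assumes fg: "(n, f) \<in> all_ops" and "unary_form n f i t" "unary_form m g j t"
  shows "clone_le C (n, f) (m, g)"
proof -
  let ?hs = "replicate m (\<lambda>xs\<in>tuples n. xs ! i)"
  have ij: "i < n" "j < m" using assms by (auto simp: unary_form_def)
  have "(\<lambda>xs\<in>tuples n. g (map (\<lambda>h. h xs) ?hs)) = restrict f (tuples n)"
  proof (rule restrict_ext)
    fix xs :: "'a list" assume xs: "xs \<in> tuples n"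
    have "replicate m (xs ! i) \<in> tuples m" by (simp add: tuples_def)
    then have "g (replicate m (xs ! i)) = t (xs ! i)"
      using assms(3) ij by (auto simp: unary_form_def)
    then show "g (map (\<lambda>h. h xs) ?hs) = f xs"
      using xs assms(2) by (simp add: unary_form_def map_replicate_const)
  qed
  then have "(n, f) = superpose n g ?hs" using fg by (simp add: superpose_def all_ops_restrict)
  moreover have "(n, h) \<in> C" if "h \<in> set ?hs" for h
    using that proj_in[OF ij(1)] by auto
  ultimately have "length ?hs = m \<and> (\<forall>h\<in>set ?hs. (n, h) \<in> C) \<and> (n, f) = superpose n g ?hs"
    by (simp del: set_replicate)
  then show ?thesis unfolding clone_le_def split by blast
qed

lemma finite_classes:
  assumes k: "CARD('a) \<ge> 3" and small: "small_ops (CARD('a) - 1) \<subseteq> C"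
  shows "finite (all_ops // clone_equiv C)"
proof -
  \<comment> \<open>This invariant has finitely many values and determines the class. Its second
    component is empty for operations without a unary form and otherwise the singleton of their map
    \<open>t\<close>.\<close>
  define \<Phi> :: "'a operation \<Rightarrow> 'a set \<times> ('a \<Rightarrow> 'a) set"
    where "\<Phi> = (\<lambda>(n, f). (op_range (n, f), {t. \<exists>i. unary_form n f i t}))"
  have le: "clone_le C f' g'" if eq: "f' \<in> all_ops" "g' \<in> all_ops" "\<Phi> f' = \<Phi> g'" for f' g'
  proof -
    obtain n f m g where e: "f' = (n, f)" "g' = (m, g)" by (cases f', cases g')
    have \<Phi>: "op_range (n, f) = op_range (m, g)"
      "{t. \<exists>i. unary_form n f i t} = {t. \<exists>i. unary_form m g i t}"
      using eq(3) by (auto simp: e \<Phi>_def)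
    show ?thesis
    proof (cases "\<exists>i t. unary_form m g i t")
      case True
      then obtain i t where "unary_form m g i t" by blast
      moreover then obtain j where "unary_form n f j t" using \<Phi>(2) by blast
      ultimately show ?thesis using clone_le_if_same_unary_form eq e by blast
    next
      case False
      then show ?thesis using clone_le_if_same_range[OF k small] \<Phi>(1) eq e by blast
    qed
  qed
  have "X = clone_equiv C `` {SOME f. f \<in> all_ops \<and> \<Phi> f = \<Phi> x}"
    if x: "x \<in> all_ops" "X = clone_equiv C `` {x}" for X x
  proof -
    let ?y = "SOME f. f \<in> all_ops \<and> \<Phi> f = \<Phi> x"
    have "?y \<in> all_ops \<and> \<Phi> ?y = \<Phi> x" by (rule someI[of _ x]) (use x in simp)
    then have "(x, ?y) \<in> clone_equiv C" using le x by (simp add: clone_equiv_def)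
    then show ?thesis using x equiv_class_eq[OF equiv_clone_equiv[OF clone]] by simp
  qed
  then have "all_ops // clone_equiv C
      \<subseteq> (\<lambda>v. clone_equiv C `` {SOME f. f \<in> all_ops \<and> \<Phi> f = v}) ` UNIV"
    by (intro subsetI, elim quotientE) (rule image_eqI, blast+)
  then show ?thesis by (rule finite_subset) simp
qed

end

section \<open>Infinitely many classes\<close>

definition diagonal_op :: "'a \<Rightarrow> nat \<Rightarrow> 'a operation" where
  "diagonal_op z n = (n, \<lambda>xs\<in>tuples n. if \<forall>x\<in>set xs. x = hd xs then hd xs else z)"

text \<open>For \<open>a\<close> other than \<open>z\<close>, a diagonal operation takes the value
  \<open>a\<close> only on the constant tuple of \<open>a\<close>. This is applied to both sides of
  the superposition.\<close>

lemma superpose_diagonal_op: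
  assumes "diagonal_op z n = superpose n (snd (diagonal_op z m)) hs" "length hs = m" "m \<ge> 1"
    and "xs \<in> tuples n" "n \<ge> 1" "a \<noteq> z"
  shows "xs = replicate n a \<longleftrightarrow> (\<forall>h\<in>set hs. h xs = a)"
proof -
  have diag: "(if \<forall>x\<in>set ys. x = hd ys then hd ys else z) = a \<longleftrightarrow> (\<forall>y\<in>set ys. y = a)"
    if "ys \<noteq> []" for ys
    using hd_in_set[OF that] \<open>a \<noteq> z\<close> by metis
  have xs: "xs \<noteq> []" "length xs = n" using assms by (auto simp: tuples_def)
  have m: "map (\<lambda>h. h xs) hs \<in> tuples m" "map (\<lambda>h. h xs) hs \<noteq> []"
    using assms(2,3) by (auto simp: tuples_def)
  have "snd (diagonal_op z n) xs = snd (diagonal_op z m) (map (\<lambda>h. h xs) hs)"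
    using assms(1,4) by (simp add: superpose_def)
  then have "(\<forall>x\<in>set xs. x = a) \<longleftrightarrow> (\<forall>y\<in>set (map (\<lambda>h. h xs) hs). y = a)"
    using diag[OF xs(1)] diag[OF m(2)] m(1) assms(4) by (simp add: diagonal_op_def)
  moreover have "xs = replicate n a \<longleftrightarrow> (\<forall>x\<in>set xs. x = a)"
    using xs(2) by (auto simp: list_eq_iff_nth_eq all_set_conv_all_nth)
  ultimately show ?thesis by simp
qed

text \<open>Equivalent diagonal operations are comparable both ways and so have the same arity; each
  of them lies in a class of its own.\<close>

lemma infinite_classes_if_monotone_arity:
  assumes "is_clone C"
    and mono: "\<And>n m. \<lbrakk>n \<ge> 1; m \<ge> 1; clone_le C (diagonal_op z n) (diagonal_op z m)\<rbrakk> \<Longrightarrow> n \<le> m"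
  shows "infinite (all_ops // clone_equiv C)"
proof
  assume fin: "finite (all_ops // clone_equiv C)"
  let ?c = "\<lambda>n. clone_equiv C `` {diagonal_op z n}"
  have ops: "diagonal_op z n \<in> all_ops" if "n \<ge> 1" for n
    using that by (simp add: diagonal_op_def)
  have "inj_on ?c {1..}"
  proof (rule inj_onI)
    fix n m :: nat assume nm: "n \<in> {1..}" "m \<in> {1..}" "?c n = ?c m"
    then have "(diagonal_op z n, diagonal_op z m) \<in> clone_equiv C"
      using eq_equiv_class[OF nm(3) equiv_clone_equiv[OF assms(1)]] ops by simp
    then have "clone_le C (diagonal_op z n) (diagonal_op z m)"
      "clone_le C (diagonal_op z m) (diagonal_op z n)" by (simp_all add: clone_equiv_def)
    then show "n = m" using mono[of n m] mono[of m n] nm(1,2) by simp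
  qed
  moreover have "?c ` {1..} \<subseteq> all_ops // clone_equiv C" using ops by (auto intro: quotientI)
  ultimately have "finite {1::nat..}" using fin by (meson finite_imageD finite_subset)
  then show False by (simp add: infinite_Ici)
qed

text \<open>The inner operations of such a comparison map the constant tuple of each
  \<open>a\<close> other than \<open>z\<close> to \<open>a\<close>, so they take at least
  \<open>CARD('a) - 1\<close> values and must be unary. Together they read at most \<open>m\<close>
  variables; if \<open>m < n\<close>, changing an unread one to \<open>z\<close> goes
  unnoticed.\<close>

lemma infinite_classes_if_range_at_most:
  fixes C :: "'a::finite operation set"
  assumes "is_clone C" "CARD('a) \<ge> 3"
    and C: "\<And>n f. \<lbrakk>(n, f) \<in> C; \<And>i t. \<not> unary_form n f i t\<rbrakk> \<Longrightarrow> card (op_range (n, f)) < CARD('a) - 1"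
  shows "infinite (all_ops // clone_equiv C)"
proof (rule infinite_classes_if_monotone_arity[OF assms(1)])
  fix z :: 'a and n m assume nm: "n \<ge> 1" "m \<ge> 1" and le: "clone_le C (diagonal_op z n) (diagonal_op z m)"
  obtain hs where hs: "length hs = m" "\<And>h. h \<in> set hs \<Longrightarrow> (n, h) \<in> C"
    "diagonal_op z n = superpose n (snd (diagonal_op z m)) hs"
    using le by (auto simp: clone_le_def diagonal_op_def)
  note diag = superpose_diagonal_op[OF hs(3) hs(1) nm(2) _ nm(1)]
  have "\<exists>i t. unary_form n h i t" if h: "h \<in> set hs" for h
  proof (rule ccontr)
    assume "\<not> ?thesis"
    then have "card (op_range (n, h)) < CARD('a) - 1" using C hs(2)[OF h] by blast
    moreover have "UNIV - {z} \<subseteq> op_range (n, h)"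
    proof
      fix a assume "a \<in> UNIV - {z}"
      then have "h (replicate n a) = a" using diag[of "replicate n a" a] h by (auto simp: tuples_def)
      moreover have "replicate n a \<in> tuples n" by (simp add: tuples_def)
      ultimately show "a \<in> op_range (n, h)" unfolding op_range_def split by (metis imageI)
    qed
    then have "card (UNIV - {z}) \<le> card (op_range (n, h))" by (intro card_mono) auto
    ultimately show False by (simp add: card_Diff_singleton)
  qed
  then obtain i t where it: "\<And>h. h \<in> set hs \<Longrightarrow> unary_form n h (i h) (t h)" by metis
  show "n \<le> m"
  proof (rule ccontr)
    assume "\<not> n \<le> m"
    have "card (i ` set hs) \<le> m" using hs(1) by (metis card_image_le card_length finite_set le_trans)
    then have "\<not> {..<n} \<subseteq> i ` set hs"
      using \<open>\<not> n \<le> m\<close> by (metis card_lessThan card_mono finite_imageI finite_set le_trans)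
    then obtain j where j: "j < n" "j \<notin> i ` set hs" by auto
    have "card {z} < CARD('a)" using assms(2) by simp
    then obtain a where a: "a \<noteq> z"
      by (metis UNIV_I card_mono finite.emptyI finite_insert not_le singletonI subsetI)
    let ?xs = "(replicate n a)[j := z]"
    have "\<forall>h\<in>set hs. h ?xs = h (replicate n a)"
    proof
      fix h assume h: "h \<in> set hs"
      then have "i h \<noteq> j" "i h < n" using j it[OF h] by (auto simp: unary_form_def)
      then show "h ?xs = h (replicate n a)" using it[OF h] by (simp add: unary_form_def tuples_def)
    qed
    moreover have "\<forall>h\<in>set hs. h (replicate n a) = a"
      using diag[of "replicate n a" a] a by (simp add: tuples_def)
    ultimately have "\<forall>h\<in>set hs. h ?xs = a" by metis
    then have "?xs = replicate n a" using diag[of ?xs a] a by (simp add: tuples_def)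
    then have "?xs ! j = a" using j by simp
    then show False using j a by simp
  qed
qed

section \<open>Affine traces on a two-element set\<close>

text \<open>Exclusive disjunction of three truth values is written \<open>a = (b = c)\<close>.\<close>

definition affine :: "nat \<Rightarrow> (bool list \<Rightarrow> bool) \<Rightarrow> bool" where
  "affine n \<chi> \<longleftrightarrow> (\<forall>x y w. length x = n \<and> length y = n \<and> length w = n \<longrightarrow>
     \<chi> (map (\<lambda>l. x ! l = (y ! l = w ! l)) [0..<n]) = (\<chi> x = (\<chi> y = \<chi> w)))"

text \<open>By the pigeonhole principle two distinct vectors \<open>x\<close> and \<open>y\<close>
  have the same values under all of \<open>\<chi>s\<close>. Affinity then gives
  \<open>x + y + w\<close> over the two-element field the same values as \<open>w\<close>.\<close>

lemma few_affine_functions_do_not_separate: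
  assumes "length \<chi>s < n" "\<And>\<chi>. \<chi> \<in> set \<chi>s \<Longrightarrow> affine n \<chi>" "length w = n"
  obtains u where "length u = n" "u \<noteq> w" "\<And>\<chi>. \<chi> \<in> set \<chi>s \<Longrightarrow> \<chi> u = \<chi> w"
proof -
  let ?S = "{bs :: bool list. length bs = n}"
  let ?T = "{bs :: bool list. length bs = length \<chi>s}"
  let ?F = "\<lambda>bs. map (\<lambda>\<chi>. \<chi> bs) \<chi>s"
  have card: "card {bs :: bool list. length bs = p} = 2 ^ p" "finite {bs :: bool list. length bs = p}" for p
    using card_lists_length_eq[of "UNIV :: bool set" p] finite_lists_length_eq[of "UNIV :: bool set" p]
    by auto
  have "card (?F ` ?S) \<le> card ?T" by (rule card_mono) (use card in auto)
  also have "\<dots> < card ?S" using assms(1) by (simp add: card)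
  finally have "\<not> inj_on ?F ?S" by (rule pigeonhole)
  then obtain x y where xy: "length x = n" "length y = n" "x \<noteq> y" "?F x = ?F y"
    by (auto simp: inj_on_def)
  let ?u = "map (\<lambda>l. x ! l = (y ! l = w ! l)) [0..<n]"
  show thesis
  proof (rule that[of ?u])
    obtain l where "l < n" "x ! l \<noteq> y ! l" using xy(1-3) by (auto simp: list_eq_iff_nth_eq)
    then have "?u ! l \<noteq> w ! l" by auto
    then show "?u \<noteq> w" by (rule contrapos_nn) simp
    fix \<chi> assume "\<chi> \<in> set \<chi>s"
    then have "\<chi> x = \<chi> y" "affine n \<chi>" using assms(2) xy(4) by simp_all
    then have "\<chi> ?u = (\<chi> y = (\<chi> y = \<chi> w))"
      using xy(1,2) assms(3) unfolding affine_def by blast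
    then show "\<chi> ?u = \<chi> w" by blast
  qed simp
qed

text \<open>Fixing a suitable argument of \<open>\<psi>\<close> leaves a binary function with an odd
  number of true values. Up to negating arguments and value, this is conjunction.\<close>

lemma conjunction_from_nonaffine:
  fixes \<psi> :: "bool \<Rightarrow> bool \<Rightarrow> bool \<Rightarrow> bool"
  assumes closed: "\<And>P Q R. \<lbrakk>P \<in> S; Q \<in> S; R \<in> S\<rbrakk> \<Longrightarrow> (\<lambda>x. \<psi> (P x) (Q x) (R x)) \<in> S"
    and const: "\<And>b. (\<lambda>x. b) \<in> S" and neg: "\<And>P. P \<in> S \<Longrightarrow> (\<lambda>x. \<not> P x) \<in> S"
    and odd: "\<psi> True True False \<noteq> (\<psi> True False True = (\<psi> False True True = \<psi> False False False))"
    and PQ: "P \<in> S" "Q \<in> S"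
  shows "(\<lambda>x. P x \<and> Q x) \<in> S"
proof -
  have xor: "(\<lambda>x. b \<noteq> P x) \<in> S" if "P \<in> S" for P b
    using that neg[OF that] by (cases b) simp_all
  have "\<exists>\<phi>. (\<forall>P Q. P \<in> S \<longrightarrow> Q \<in> S \<longrightarrow> (\<lambda>x. \<phi> (P x) (Q x)) \<in> S) \<and>
    \<phi> True True \<noteq> (\<phi> True False = (\<phi> False True = \<phi> False False))"
  proof -
    \<comment> \<open>the values on the even vertices of a cube have even sum if those on every face do\<close>
    have "\<exists>b. \<psi> True True b \<noteq> (\<psi> True False b = (\<psi> False True b = \<psi> False False b))
       \<or> \<psi> True b True \<noteq> (\<psi> True b False = (\<psi> False b True = \<psi> False b False))
       \<or> \<psi> b True True \<noteq> (\<psi> b True False = (\<psi> b False True = \<psi> b False False))"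
      using odd unfolding ex_bool_eq by argo
    then obtain b where "\<psi> True True b \<noteq> (\<psi> True False b = (\<psi> False True b = \<psi> False False b))
       \<or> \<psi> True b True \<noteq> (\<psi> True b False = (\<psi> False b True = \<psi> False b False))
       \<or> \<psi> b True True \<noteq> (\<psi> b True False = (\<psi> b False True = \<psi> b False False))" ..
    then show ?thesis
    proof (elim disjE)
      assume "\<psi> True True b \<noteq> (\<psi> True False b = (\<psi> False True b = \<psi> False False b))"
      then show ?thesis by (intro exI[of _ "\<lambda>p q. \<psi> p q b"]) (simp add: closed const)
    next
      assume "\<psi> True b True \<noteq> (\<psi> True b False = (\<psi> False b True = \<psi> False b False))"
      then show ?thesis by (intro exI[of _ "\<lambda>p q. \<psi> p b q"]) (simp add: closed const)
    next
      assume "\<psi> b True True \<noteq> (\<psi> b True False = (\<psi> b False True = \<psi> b False False))"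
      then show ?thesis by (intro exI[of _ "\<lambda>p q. \<psi> b p q"]) (simp add: closed const)
    qed
  qed
  then obtain \<phi> where \<phi>: "\<And>P Q. P \<in> S \<Longrightarrow> Q \<in> S \<Longrightarrow> (\<lambda>x. \<phi> (P x) (Q x)) \<in> S"
    "\<phi> True True \<noteq> (\<phi> True False = (\<phi> False True = \<phi> False False))" by blast
  have "\<exists>a b c. \<forall>p q. (p \<and> q) = (c \<noteq> \<phi> (a \<noteq> p) (b \<noteq> q))"
    using \<phi>(2) by (cases "\<phi> True True"; cases "\<phi> True False"; cases "\<phi> False True"; cases "\<phi> False False")
      (simp_all add: ex_bool_eq all_bool_eq)
  then obtain a b c where abc: "\<And>p q. (p \<and> q) = (c \<noteq> \<phi> (a \<noteq> p) (b \<noteq> q))" by blast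
  show ?thesis unfolding abc using xor[OF \<phi>(1)[OF xor[OF PQ(1)] xor[OF PQ(2)]]] .
qed

section \<open>Predicates definable in the clone\<close>

locale boolean_trace = clone_above_T_minus C for C :: "'a::finite operation set" +
  fixes c0 c1 :: 'a
  assumes distinct: "c0 \<noteq> c1" and three_elements: "CARD('a) \<ge> 3"
begin

text \<open>The predicates live on tuples over the whole base set, not only over \<open>c0\<close>
  and \<open>c1\<close>; their values on lists of other lengths are irrelevant.\<close>

definition definable :: "nat \<Rightarrow> ('a list \<Rightarrow> bool) set" where
  "definable n = {P. (n, \<lambda>xs\<in>tuples n. if P xs then c1 else c0) \<in> C}"

text \<open>Comparing with \<open>v\<close> is a two-valued map, hence no permutation of at least
  three elements.\<close>

lemma definable_eq:
  assumes "(n, restrict f (tuples n)) \<in> C" shows "(\<lambda>xs. f xs = v) \<in> definable n"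
proof -
  have "\<not> bij (\<lambda>a. if a = v then c1 else c0)"
    by (rule not_bij_if_range[of _ "{c0, c1}"]) (use three_elements distinct in auto)
  from unary_comp_in[OF assms this] show ?thesis by (simp add: definable_def)
qed

lemma definable_const:
  assumes "0 < n" shows "(\<lambda>xs. b) \<in> definable n"
proof -
  have "\<not> bij (\<lambda>a :: 'a. if b then c1 else c0)"
    by (rule not_bij_if_range[of _ "{c0, c1}"]) (use three_elements distinct in auto)
  from unary_comp_in[OF proj_in[OF assms] this] show ?thesis by (simp add: definable_def)
qed

lemma definable_not:
  assumes "P \<in> definable n" shows "(\<lambda>xs. \<not> P xs) \<in> definable n"
proof -
  have "(\<lambda>xs. (if P xs then c1 else c0) = c0) \<in> definable n"
    by (rule definable_eq) (use assms in \<open>simp add: definable_def\<close>)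
  moreover have "(\<lambda>xs. (if P xs then c1 else c0) = c0) = (\<lambda>xs. \<not> P xs)" using distinct by auto
  ultimately show ?thesis by simp
qed

lemma definable_subst:
  assumes "(m, h) \<in> C" "length Ps = m" "\<And>P. P \<in> set Ps \<Longrightarrow> P \<in> definable n"
  shows "(\<lambda>xs. h (map (\<lambda>P. if P xs then c1 else c0) Ps) = v) \<in> definable n"
proof (rule definable_eq)
  have "(n, \<lambda>xs\<in>tuples n. h (map (\<lambda>h. h xs) (map (\<lambda>P xs. if P xs then c1 else c0) Ps))) \<in> C"
    by (rule compose_in[OF assms(1)]) (use assms in \<open>auto simp: definable_def\<close>)
  then show "(n, \<lambda>xs\<in>tuples n. h (map (\<lambda>P. if P xs then c1 else c0) Ps)) \<in> C"
    by (simp add: o_def)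
qed

text \<open>Values of \<open>h\<close> outside \<open>c0\<close> and \<open>c1\<close> count as
  false, so a Boolean function arises even if \<open>h\<close> does not preserve the two-element
  set.\<close>

definition trace :: "('a list \<Rightarrow> 'a) \<Rightarrow> bool list \<Rightarrow> bool" where
  "trace h bs \<longleftrightarrow> h (map (\<lambda>b. if b then c1 else c0) bs) = c1"

text \<open>A failure of affinity at \<open>x\<close>, \<open>y\<close>, \<open>w\<close> is turned
  into a ternary function that meets the parity condition of
  \<open>conjunction_from_nonaffine\<close>.\<close>

lemma definable_conj_if_not_affine:
  assumes h: "(m, h) \<in> C" "\<not> affine m (trace h)" and "0 < n"
    and PQ: "P \<in> definable n" "Q \<in> definable n"
  shows "(\<lambda>xs. P xs \<and> Q xs) \<in> definable n"
proof -
  obtain x y w where xyw: "length x = m" "length y = m" "length w = m"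
    and odd: "trace h (map (\<lambda>l. x ! l = (y ! l = w ! l)) [0..<m]) \<noteq> (trace h x = (trace h y = trace h w))"
    using h(2) by (auto simp: affine_def)
  \<comment> \<open>Coordinate \<open>l\<close> is \<open>w ! l\<close>, negated according to
    \<open>p\<close> if only \<open>x\<close> differs from \<open>w\<close> there, to
    \<open>q\<close> if only \<open>y\<close> does, and to \<open>r\<close> if both do. It is thus a
    constant, a variable or a negated variable, and four corners of the cube give \<open>w\<close>,
    \<open>x\<close>, \<open>y\<close> and \<open>x + y + w\<close>.\<close>
  define coord where "coord l p q r = (w ! l \<noteq> (if x ! l \<noteq> w ! l then if y ! l \<noteq> w ! l then r else p
    else if y ! l \<noteq> w ! l then q else False))" for l p q r
  define \<psi> where "\<psi> p q r = trace h (map (\<lambda>l. coord l p q r) [0..<m])" for p q r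
  have "map (\<lambda>l. coord l False False False) [0..<m] = w" "map (\<lambda>l. coord l True False True) [0..<m] = x"
    "map (\<lambda>l. coord l False True True) [0..<m] = y"
    "map (\<lambda>l. coord l True True False) [0..<m] = map (\<lambda>l. x ! l = (y ! l = w ! l)) [0..<m]"
    using xyw by (auto simp: coord_def intro!: nth_equalityI)
  then have \<psi>: "\<psi> True True False \<noteq> (\<psi> True False True = (\<psi> False True True = \<psi> False False False))"
    using odd unfolding \<psi>_def by (simp only: not_False_eq_True)
  show ?thesis
  proof (rule conjunction_from_nonaffine[OF _ _ _ \<psi> PQ])
    fix P Q R assume PQR: "P \<in> definable n" "Q \<in> definable n" "R \<in> definable n"
    have coord: "(\<lambda>xs. coord l (P xs) (Q xs) (R xs)) \<in> definable n" for l
      using PQR definable_not definable_const[OF \<open>0 < n\<close>]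
      by (cases "x ! l"; cases "y ! l"; cases "w ! l") (simp_all add: coord_def)
    let ?Ps = "map (\<lambda>l xs. coord l (P xs) (Q xs) (R xs)) [0..<m]"
    have "(\<lambda>xs. h (map (\<lambda>P. if P xs then c1 else c0) ?Ps) = c1) \<in> definable n"
      by (rule definable_subst[OF h(1)]) (use coord in auto)
    then show "(\<lambda>xs. \<psi> (P xs) (Q xs) (R xs)) \<in> definable n"
      by (simp add: \<psi>_def trace_def o_def)
  qed (use definable_not definable_const \<open>0 < n\<close> in auto)
qed

text \<open>Single tuples are definable as conjunctions of equations between entries and constants,
  and any predicate on the finite set of tuples is a finite disjunction of these.\<close>

lemma all_definable_if_conj:
  assumes "0 < n"
    and conj: "\<And>P Q. \<lbrakk>P \<in> definable n; Q \<in> definable n\<rbrakk> \<Longrightarrow> (\<lambda>xs. P xs \<and> Q xs) \<in> definable n"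
  shows "P \<in> definable n"
proof -
  have cong: "P \<in> definable n \<longleftrightarrow> Q \<in> definable n" if "\<And>xs. length xs = n \<Longrightarrow> P xs = Q xs" for P Q
  proof -
    have "(\<lambda>xs\<in>tuples n. if P xs then c1 else c0) = (\<lambda>xs\<in>tuples n. if Q xs then c1 else c0)"
      using that by (intro restrict_ext) (simp add: tuples_def)
    then show ?thesis by (simp add: definable_def)
  qed
  have disj: "(\<lambda>xs. P xs \<or> Q xs) \<in> definable n" if "P \<in> definable n" "Q \<in> definable n" for P Q
    using definable_not[OF conj[OF definable_not[OF that(1)] definable_not[OF that(2)]]] by simp
  have prefix: "(\<lambda>xs. \<forall>l<m. xs ! l = a ! l) \<in> definable n" if "m \<le> n" for m and a :: "'a list"
    using that
  proof (induction m)
    case (Suc m)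
    then have "(\<lambda>xs. xs ! m = a ! m) \<in> definable n" by (intro definable_eq proj_in) simp
    moreover have "(\<lambda>xs. \<forall>l<m. xs ! l = a ! l) \<in> definable n" using Suc by simp
    ultimately have "(\<lambda>xs. xs ! m = a ! m \<and> (\<forall>l<m. xs ! l = a ! l)) \<in> definable n" by (rule conj)
    then show ?case by (simp add: All_less_Suc)
  qed (simp add: definable_const[OF \<open>0 < n\<close>])
  have point: "(\<lambda>xs. xs = a) \<in> definable n" if "length a = n" for a
    using prefix[OF order_refl, of a] cong[of "\<lambda>xs. xs = a"] that by (simp add: list_eq_iff_nth_eq)
  have "(\<lambda>xs. xs \<in> Y) \<in> definable n" if "finite Y" "Y \<subseteq> tuples n" for Y
    using that
  proof (induction Y rule: finite_induct)
    case (insert a Y)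
    then show ?case using disj[OF point[of a], of "\<lambda>xs. xs \<in> Y"] by (simp add: tuples_def)
  qed (simp add: definable_const[OF \<open>0 < n\<close>])
  moreover have "finite (tuples n :: 'a list set)"
    using finite_lists_length_eq[of "UNIV :: 'a set" n] by (simp add: tuples_def)
  then have "finite {xs \<in> tuples n. P xs}" by simp
  ultimately have "(\<lambda>xs. xs \<in> {xs \<in> tuples n. P xs}) \<in> definable n" by blast
  then show ?thesis by (subst cong) (simp_all add: tuples_def)
qed

lemma small_ops_2_subset_if_not_affine:
  assumes h: "(m, h) \<in> C" "\<not> affine m (trace h)"
  shows "small_ops 2 \<subseteq> C"
proof
  fix f' :: "'a operation" assume f': "f' \<in> small_ops 2"
  obtain n f where f: "f' = (n, f)" by (cases f')
  have fo: "(n, f) \<in> all_ops" "card (f ` tuples n) \<le> 2" "0 < n"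
    using f' f by (auto simp: small_ops_def op_range_def all_ops_def)
  obtain a b where ab: "f ` tuples n \<subseteq> {a, b}"
  proof -
    obtain B where "f ` tuples n \<subseteq> B" "card B = 2"
      using fo three_elements exists_subset_between[of "f ` tuples n" 2 UNIV] by auto
    then show ?thesis using that by (auto simp: card_2_iff)
  qed
  have "(\<lambda>xs. f xs = a) \<in> definable n"
    using all_definable_if_conj definable_conj_if_not_affine[OF h] fo(3) by blast
  then have "(n, \<lambda>xs\<in>tuples n. if f xs = a then c1 else c0) \<in> C" by (simp add: definable_def)
  \<comment> \<open>This map decodes the characteristic operation into the two values of
    \<open>f\<close>.\<close>
  moreover have "\<not> bij (\<lambda>x. if x = c1 then a else b)"
  proof (rule not_bij_if_range[of _ "{a, b}"])
    show "card {a, b} < CARD('a)" using three_elements by (cases "a = b") auto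
  qed auto
  ultimately have "(n, \<lambda>xs\<in>tuples n. if (if f xs = a then c1 else c0) = c1 then a else b) \<in> C"
    by (rule unary_comp_in)
  also have "(\<lambda>xs\<in>tuples n. if (if f xs = a then c1 else c0) = c1 then a else b) = restrict f (tuples n)"
    using ab distinct by (intro restrict_ext) auto
  finally show "f' \<in> C" using f fo by (simp add: all_ops_restrict)
qed

text \<open>On tuples over \<open>c0\<close> and \<open>c1\<close>, the comparison expresses being
  constantly \<open>c1\<close> as a conjunction of \<open>m\<close> affine conditions. Fewer than
  \<open>n\<close> of them cannot single out one Boolean vector.\<close>

lemma infinite_classes_if_affine:
  assumes affine: "\<And>m h. (m, h) \<in> C \<Longrightarrow> affine m (trace h)"
  shows "infinite (all_ops // clone_equiv C)"
proof (rule infinite_classes_if_monotone_arity[OF clone])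
  fix n m assume nm: "n \<ge> 1" "m \<ge> 1" and le: "clone_le C (diagonal_op c0 n) (diagonal_op c0 m)"
  obtain hs where hs: "length hs = m" "\<And>h. h \<in> set hs \<Longrightarrow> (n, h) \<in> C"
    "diagonal_op c0 n = superpose n (snd (diagonal_op c0 m)) hs"
    using le by (auto simp: clone_le_def diagonal_op_def)
  let ?e = "map (\<lambda>b. if b then c1 else c0)"
  have diag: "?e u = replicate n c1 \<longleftrightarrow> (\<forall>h\<in>set hs. trace h u)" if "length u = n" for u
    using superpose_diagonal_op[OF hs(3) hs(1) nm(2) _ nm(1), of "?e u" c1] distinct that
    by (simp add: tuples_def trace_def)
  let ?w = "replicate n True"
  show "n \<le> m"
  proof (rule ccontr)
    assume "\<not> n \<le> m"
    then have "length (map trace hs) < n" using hs(1) by simp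
    moreover have "affine n \<chi>" if "\<chi> \<in> set (map trace hs)" for \<chi>
      using that hs(2) affine by auto
    ultimately obtain u where u: "length u = n" "u \<noteq> ?w" "\<And>\<chi>. \<chi> \<in> set (map trace hs) \<Longrightarrow> \<chi> u = \<chi> ?w"
      by (rule few_affine_functions_do_not_separate[where w = ?w]) simp_all
    have "\<forall>h\<in>set hs. trace h ?w" using diag[of ?w] by simp
    then have "\<forall>h\<in>set hs. trace h u" using u(3) by auto
    then have "?e u = replicate n c1" using diag[OF u(1)] by blast
    then have "\<forall>l<n. u ! l" using u(1) distinct by (auto simp: list_eq_iff_nth_eq split: if_splits)
    then show False using u(1,2) by (simp add: list_eq_iff_nth_eq)
  qed
qed

end

section \<open>From finitely many classes to all operations of small range\<close>

context clone_above_T_minus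
begin

lemma small_ops_subset_if_finite_classes:
  assumes k: "CARD('a) \<ge> 3" and fin: "finite (all_ops // clone_equiv C)"
  shows "small_ops (CARD('a) - 1) \<subseteq> C"
proof -
  obtain c0 c1 :: 'a where "c0 \<noteq> c1"
    using k card_le_Suc0_iff_eq[of "UNIV :: 'a set"] by auto
  then interpret boolean_trace C c0 c1 using k by unfold_locales
  have base: "small_ops 2 \<subseteq> C"
    using infinite_classes_if_affine small_ops_2_subset_if_not_affine fin by blast
  have "2 \<le> r \<Longrightarrow> r < CARD('a) \<Longrightarrow> small_ops r \<subseteq> C" for r
  proof (induction r rule: dec_induct)
    case (step r)
    \<comment> \<open>Otherwise all members without a unary form have at most
      \<open>r < CARD('a) - 1\<close> values, which gives infinitely many classes.\<close>
    have "\<exists>m g. (m, g) \<in> C \<and> (\<forall>i t. \<not> unary_form m g i t) \<and> r < card (op_range (m, g))"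
    proof (rule ccontr)
      assume "\<not> ?thesis"
      then have "card (op_range (m, g)) < CARD('a) - 1"
        if "(m, g) \<in> C" "\<And>i t. \<not> unary_form m g i t" for m g
        using that step.prems by fastforce
      then show False using infinite_classes_if_range_at_most[OF clone k] fin by blast
    qed
    then show ?case
      using small_ops_Suc_subset[OF step.hyps(1) step.prems step.IH] step.prems by auto
  qed (use base in simp)
  then show ?thesis using k by simp
qed

text \<open>The two sets differ only in essentially unary operations. Those of small range are
  non-permutations applied to a projection; those in \<open>slupecki_T_minus\<close> are generated
  by \<open>T_minus\<close>. Both kinds lie in \<open>C\<close> anyway.\<close>

lemma slupecki_T_minus_subset_iff:
  assumes "CARD('a) \<ge> 3"
  shows "slupecki_T_minus \<subseteq> C \<longleftrightarrow> small_ops (CARD('a) - 1) \<subseteq> C"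
proof
  assume sub: "slupecki_T_minus \<subseteq> C"
  show "small_ops (CARD('a) - 1) \<subseteq> C"
  proof
    fix f' :: "'a operation" assume f': "f' \<in> small_ops (CARD('a) - 1)"
    obtain n f where f: "f' = (n, f)" by (cases f')
    have fo: "(n, f) \<in> all_ops" "card (f ` tuples n) \<le> CARD('a) - 1"
      using f' f by (auto simp: small_ops_def op_range_def)
    show "f' \<in> C"
    proof (cases "f' \<in> essentially_unary")
      case True
      then obtain i t where it: "unary_form n f i t" using essentially_unary_imp_unary_form[of n f] f by blast
      have "range t \<subseteq> f ` tuples n"
      proof
        fix b assume "b \<in> range t"
        then obtain a where "b = t a" by blast
        then have "b = f (replicate n a)" using it by (simp add: unary_form_def tuples_def)
        then show "b \<in> f ` tuples n" by (rule image_eqI) (simp add: tuples_def)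
      qed
      then have "\<not> bij t" by (rule not_bij_if_range) (use fo assms in linarith)
      moreover have "(n, \<lambda>xs\<in>tuples n. xs ! i) \<in> C"
        using it by (intro proj_in) (simp add: unary_form_def)
      ultimately have "(n, \<lambda>xs\<in>tuples n. t (xs ! i)) \<in> C" by (rule unary_comp_in[rotated])
      also have "(\<lambda>xs\<in>tuples n. t (xs ! i)) = restrict f (tuples n)"
        using it by (intro restrict_ext) (simp add: unary_form_def)
      finally show ?thesis using f fo by (simp add: all_ops_restrict)
    next
      case False
      then have "f' \<in> slupecki_T_minus"
        using f' by (simp add: slupecki_T_minus_def slupecki_def small_ops_def)
      then show ?thesis using sub by blast
    qed
  qed
next
  assume "small_ops (CARD('a) - 1) \<subseteq> C"
  moreover have "clone_generated T_minus \<subseteq> C"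
    using clone T_minus unfolding clone_generated_def by blast
  ultimately show "slupecki_T_minus \<subseteq> C"
    unfolding slupecki_T_minus_def slupecki_def small_ops_def by blast
qed

end

theorem theorem6p1:
  fixes C :: "'a::finite operation set" and k :: nat
  assumes "CARD('a) = k" and "k \<ge> 3"
    and "is_clone C" and "T_minus \<subseteq> C"
  shows "C \<in> finitely_many_classes \<longleftrightarrow> slupecki_T_minus \<subseteq> C"
proof -
  interpret clone_above_T_minus C using assms by unfold_locales
  have k: "CARD('a) \<ge> 3" using assms by simp
  show ?thesis
    using finite_classes[OF k] small_ops_subset_if_finite_classes[OF k]
      slupecki_T_minus_subset_iff[OF k] clone
    by (auto simp: finitely_many_classes_def)
qed

end
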